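(* Let $\mathbf{Q}$ be Robinson arithmetic and let $\mathbf{Q}^\omega$ denote $\mathbf{Q}$ formalized in inferential $\omega$-logic, where the distinguished countable set of constants $\mathrm{Const}(\tau_N)$ names (via a valuation onto) the elements of the standard model $\mathbf N=\langle\mathbb N,0,S,+,\times\rangle$. Then the standard model of $\mathbf{Q}$ has no proper extension satisfying $\mathbf{Q}^\omega$ (i.e. no proper extension carries an admissible valuation), and hence $\mathbf{Q}^\omega$ is categorical (all its models are isomorphic).
   Context: Robinson's $\mathbf Q$ is the finitely axiomatized first-order theory in the vocabulary with constant $0$, unary function $S$ and binary functions $+,\times$, with axioms: $Sx\neq 0$; $Sx=Sy\to x=y$; $x\neq0\to\exists y\,(x=Sy)$; $x+0=x$; $x+Sy=S(x+y)$; $x\times0=0$; $x\times Sy=x\times y+x$. A valuation assigns truth values to sentences; it is permissible if it assigns values to all quantifier-free sentences, the sentences made true are consistent, and it respects the identity rules; it is admissible if every rule instance with true premises has a true conclusion. Models are given by admissible valuations with Robinson semantics: a structure $M$ is named by constants of an expanded vocabulary $\tau_M\supseteq\tau_N$. Inferential $\omega$-logic adds, for any countable set $C$ of constants containing the distinguished set $\mathrm{Const}(\tau_N)$ and any formula $\phi(x,\bar d)$ with parameters from $C$: $I$-$\omega$-rule: from $\{\phi(c,\bar d):c\in\mathrm{Const}(\tau_N)\}$ infer $(\forall x)\phi(x,\bar d)$; $I$-$\forall E$: from $(\forall x)\phi(x,\bar d)$ infer $\phi(e,\bar d)$ for each $e\in C$; and the corresponding existential rules. *)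

theory Defs
  imports Main "HOL-Library.Countable_Set"
begin

section \<open>Syntax\<close>

text \<open>The vocabulary consists of \<open>0, S, +, \<times>\<close> and additional constants taken from the type \<open>'c\<close>.
  A particular vocabulary \<open>\<tau>\<close> is given by the set of those elements of \<open>'c\<close> that belong to it.\<close>

datatype 'c tm =
    Var nat
  | Cst 'c
  | Zero
  | Succ "'c tm"
  | Plus "'c tm" "'c tm"
  | Times "'c tm" "'c tm"

datatype 'c fm =
    Eq "'c tm" "'c tm"
  | Neg "'c fm"
  | Conj "'c fm" "'c fm"
  | Disj "'c fm" "'c fm"
  | Imp "'c fm" "'c fm"
  | All nat "'c fm"
  | Ex nat "'c fm"

primrec fv_tm :: "'c tm \<Rightarrow> nat set" where
  "fv_tm (Var x) = {x}"
| "fv_tm (Cst c) = {}"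
| "fv_tm Zero = {}"
| "fv_tm (Succ t) = fv_tm t"
| "fv_tm (Plus s t) = fv_tm s \<union> fv_tm t"
| "fv_tm (Times s t) = fv_tm s \<union> fv_tm t"

primrec fv :: "'c fm \<Rightarrow> nat set" where
  "fv (Eq s t) = fv_tm s \<union> fv_tm t"
| "fv (Neg p) = fv p"
| "fv (Conj p q) = fv p \<union> fv q"
| "fv (Disj p q) = fv p \<union> fv q"
| "fv (Imp p q) = fv p \<union> fv q"
| "fv (All x p) = fv p - {x}"
| "fv (Ex x p) = fv p - {x}"

text \<open>The additional constants occurring in terms and formulas are given by the generated
  functions \<open>set_tm\<close> and \<open>set_fm\<close>.\<close>

primrec quantifier_free :: "'c fm \<Rightarrow> bool" where
  "quantifier_free (Eq s t) = True"
| "quantifier_free (Neg p) = quantifier_free p"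
| "quantifier_free (Conj p q) = (quantifier_free p \<and> quantifier_free q)"
| "quantifier_free (Disj p q) = (quantifier_free p \<and> quantifier_free q)"
| "quantifier_free (Imp p q) = (quantifier_free p \<and> quantifier_free q)"
| "quantifier_free (All x p) = False"
| "quantifier_free (Ex x p) = False"

primrec subst_tm :: "nat \<Rightarrow> 'c tm \<Rightarrow> 'c tm \<Rightarrow> 'c tm" where
  "subst_tm x u (Var y) = (if y = x then u else Var y)"
| "subst_tm x u (Cst c) = Cst c"
| "subst_tm x u Zero = Zero"
| "subst_tm x u (Succ t) = Succ (subst_tm x u t)"
| "subst_tm x u (Plus s t) = Plus (subst_tm x u s) (subst_tm x u t)"
| "subst_tm x u (Times s t) = Times (subst_tm x u s) (subst_tm x u t)"

text \<open>\<open>subst x u p\<close> is used for closed terms \<open>u\<close> only, so variable capture cannot occur.\<close>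

primrec subst :: "nat \<Rightarrow> 'c tm \<Rightarrow> 'c fm \<Rightarrow> 'c fm" where
  "subst x u (Eq s t) = Eq (subst_tm x u s) (subst_tm x u t)"
| "subst x u (Neg p) = Neg (subst x u p)"
| "subst x u (Conj p q) = Conj (subst x u p) (subst x u q)"
| "subst x u (Disj p q) = Disj (subst x u p) (subst x u q)"
| "subst x u (Imp p q) = Imp (subst x u p) (subst x u q)"
| "subst x u (All y p) = (if y = x then All y p else All y (subst x u p))"
| "subst x u (Ex y p) = (if y = x then Ex y p else Ex y (subst x u p))"

definition closed_terms :: "'c set \<Rightarrow> 'c tm set" where
  "closed_terms C = {t. fv_tm t = {} \<and> set_tm t \<subseteq> C}"

definition sentences :: "'c set \<Rightarrow> 'c fm set" where
  "sentences C = {p. fv p = {} \<and> set_fm p \<subseteq> C}"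

definition formulas_in :: "nat \<Rightarrow> 'c set \<Rightarrow> 'c fm set" where
  "formulas_in x C = {p. fv p \<subseteq> {x} \<and> set_fm p \<subseteq> C}"

section \<open>Robinson arithmetic\<close>

definition robinson_Q :: "'c fm set" where
  "robinson_Q =
    { All 0 (Neg (Eq (Succ (Var 0)) Zero)),
      All 0 (All 1 (Imp (Eq (Succ (Var 0)) (Succ (Var 1))) (Eq (Var 0) (Var 1)))),
      All 0 (Imp (Neg (Eq (Var 0) Zero)) (Ex 1 (Eq (Var 0) (Succ (Var 1))))),
      All 0 (Eq (Plus (Var 0) Zero) (Var 0)),
      All 0 (All 1 (Eq (Plus (Var 0) (Succ (Var 1))) (Succ (Plus (Var 0) (Var 1))))),
      All 0 (Eq (Times (Var 0) Zero) Zero),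
      All 0 (All 1 (Eq (Times (Var 0) (Succ (Var 1))) (Plus (Times (Var 0) (Var 1)) (Var 0)))) }"

section \<open>Inferential omega-logic\<close>

text \<open>\<open>K\<close> is the distinguished set \<open>Const(\<tau>\<^sub>N)\<close> and \<open>V\<close> the set of all constants of the vocabulary
  \<open>\<tau>\<^sub>M\<close>. The set \<open>C\<close> in the quantifier rules ranges over the countable sets of constants between
  \<open>K\<close> and \<open>V\<close>; \<open>V\<close> itself may be uncountable.\<close>

definition param_sets :: "'c set \<Rightarrow> 'c set \<Rightarrow> 'c set set" where
  "param_sets K V = {C. countable C \<and> K \<subseteq> C \<and> C \<subseteq> V}"

inductive derives :: "'c set \<Rightarrow> 'c set \<Rightarrow> 'c fm set \<Rightarrow> 'c fm \<Rightarrow> bool" for K V where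
  Assm: "p \<in> G \<Longrightarrow> p \<in> sentences V \<Longrightarrow> derives K V G p"
| NegI: "p \<in> sentences V \<Longrightarrow> derives K V (insert p G) q \<Longrightarrow> derives K V (insert p G) (Neg q) \<Longrightarrow>
    derives K V G (Neg p)"
| NegE: "derives K V G p \<Longrightarrow> derives K V G (Neg p) \<Longrightarrow> q \<in> sentences V \<Longrightarrow> derives K V G q"
| DNegE: "derives K V G (Neg (Neg p)) \<Longrightarrow> derives K V G p"
| ConjI: "derives K V G p \<Longrightarrow> derives K V G q \<Longrightarrow> derives K V G (Conj p q)"
| ConjE1: "derives K V G (Conj p q) \<Longrightarrow> derives K V G p"
| ConjE2: "derives K V G (Conj p q) \<Longrightarrow> derives K V G q"
| DisjI1: "derives K V G p \<Longrightarrow> q \<in> sentences V \<Longrightarrow> derives K V G (Disj p q)"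
| DisjI2: "derives K V G q \<Longrightarrow> p \<in> sentences V \<Longrightarrow> derives K V G (Disj p q)"
| DisjE: "derives K V G (Disj p q) \<Longrightarrow> derives K V (insert p G) r \<Longrightarrow> derives K V (insert q G) r \<Longrightarrow>
    derives K V G r"
| ImpI: "p \<in> sentences V \<Longrightarrow> derives K V (insert p G) q \<Longrightarrow> derives K V G (Imp p q)"
| ImpE: "derives K V G (Imp p q) \<Longrightarrow> derives K V G p \<Longrightarrow> derives K V G q"
| EqI: "t \<in> closed_terms V \<Longrightarrow> derives K V G (Eq t t)"
| EqE: "s \<in> closed_terms V \<Longrightarrow> t \<in> closed_terms V \<Longrightarrow> p \<in> formulas_in x V \<Longrightarrow>
    derives K V G (Eq s t) \<Longrightarrow> derives K V G (subst x s p) \<Longrightarrow> derives K V G (subst x t p)"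
| AllI_omega: "C \<in> param_sets K V \<Longrightarrow> p \<in> formulas_in x C \<Longrightarrow>
    (\<forall>c\<in>K. derives K V G (subst x (Cst c) p)) \<Longrightarrow> derives K V G (All x p)"
| AllE: "C \<in> param_sets K V \<Longrightarrow> p \<in> formulas_in x C \<Longrightarrow> e \<in> C \<Longrightarrow>
    derives K V G (All x p) \<Longrightarrow> derives K V G (subst x (Cst e) p)"
| ExI: "C \<in> param_sets K V \<Longrightarrow> p \<in> formulas_in x C \<Longrightarrow> e \<in> C \<Longrightarrow>
    derives K V G (subst x (Cst e) p) \<Longrightarrow> derives K V G (Ex x p)"
| ExE_omega: "C \<in> param_sets K V \<Longrightarrow> p \<in> formulas_in x C \<Longrightarrow> derives K V G (Ex x p) \<Longrightarrow>
    r \<in> sentences V \<Longrightarrow> (\<forall>c\<in>K. derives K V (insert (subst x (Cst c) p) G) r) \<Longrightarrow> derives K V G r"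

definition consistent :: "'c set \<Rightarrow> 'c set \<Rightarrow> 'c fm set \<Rightarrow> bool" where
  "consistent K V G \<longleftrightarrow> \<not> (\<exists>p. derives K V G p \<and> derives K V G (Neg p))"

section \<open>Valuations\<close>

type_synonym 'c valuation = "'c fm \<rightharpoonup> bool"

definition made_true :: "'c valuation \<Rightarrow> 'c fm set" where
  "made_true v = {p. v p = Some True}"

definition respects_identity :: "'c set \<Rightarrow> 'c valuation \<Rightarrow> bool" where
  "respects_identity V v \<longleftrightarrow>
    (\<forall>t\<in>closed_terms V. Eq t t \<in> made_true v) \<and>
    (\<forall>s\<in>closed_terms V. \<forall>t\<in>closed_terms V. \<forall>x. \<forall>p\<in>formulas_in x V.
      Eq s t \<in> made_true v \<longrightarrow> subst x s p \<in> made_true v \<longrightarrow> subst x t p \<in> made_true v)"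

definition permissible :: "'c set \<Rightarrow> 'c set \<Rightarrow> 'c valuation \<Rightarrow> bool" where
  "permissible K V v \<longleftrightarrow>
    dom v \<subseteq> sentences V \<and>
    {p \<in> sentences V. quantifier_free p} \<subseteq> dom v \<and>
    consistent K V (made_true v) \<and>
    respects_identity V v"

text \<open>Since some rules discharge assumptions, the instances of the rules are the sequents that
  the rules generate. In particular, the set of all \<open>\<phi>(c)\<close> with \<open>c \<in> K\<close> is the premise set of
  such an instance, with conclusion \<open>(\<forall>x)\<phi>(x)\<close>.\<close>

definition admissible :: "'c set \<Rightarrow> 'c set \<Rightarrow> 'c valuation \<Rightarrow> bool" where
  "admissible K V v \<longleftrightarrow>
    permissible K V v \<and> (\<forall>G p. derives K V G p \<longrightarrow> G \<subseteq> made_true v \<longrightarrow> p \<in> made_true v)"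

section \<open>Structures\<close>

record 'a arith =
  univ :: "'a set"
  zero_el :: 'a
  succ_op :: "'a \<Rightarrow> 'a"
  plus_op :: "'a \<Rightarrow> 'a \<Rightarrow> 'a"
  times_op :: "'a \<Rightarrow> 'a \<Rightarrow> 'a"

definition is_structure :: "'a arith \<Rightarrow> bool" where
  "is_structure M \<longleftrightarrow>
    zero_el M \<in> univ M \<and>
    (\<forall>a\<in>univ M. succ_op M a \<in> univ M) \<and>
    (\<forall>a\<in>univ M. \<forall>b\<in>univ M. plus_op M a b \<in> univ M \<and> times_op M a b \<in> univ M)"

definition standard_model :: "nat arith" where
  "standard_model = \<lparr>univ = UNIV, zero_el = 0, succ_op = Suc, plus_op = (+), times_op = (*)\<rparr>"

definition embedding :: "('a \<Rightarrow> 'b) \<Rightarrow> 'a arith \<Rightarrow> 'b arith \<Rightarrow> bool" where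
  "embedding f M N \<longleftrightarrow>
    is_structure M \<and> is_structure N \<and>
    f ` univ M \<subseteq> univ N \<and> inj_on f (univ M) \<and>
    f (zero_el M) = zero_el N \<and>
    (\<forall>a\<in>univ M. f (succ_op M a) = succ_op N (f a)) \<and>
    (\<forall>a\<in>univ M. \<forall>b\<in>univ M. f (plus_op M a b) = plus_op N (f a) (f b) \<and>
      f (times_op M a b) = times_op N (f a) (f b))"

text \<open>Extensions are taken up to identification of \<open>M\<close> with its image, as the universes of
  \<open>M\<close> and \<open>N\<close> may live in different types.\<close>

definition proper_extension :: "'a arith \<Rightarrow> 'b arith \<Rightarrow> bool" where
  "proper_extension M N \<longleftrightarrow> (\<exists>f. embedding f M N \<and> f ` univ M \<noteq> univ N)"

definition isomorphic :: "'a arith \<Rightarrow> 'b arith \<Rightarrow> bool" where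
  "isomorphic M N \<longleftrightarrow> (\<exists>f. embedding f M N \<and> f ` univ M = univ N)"

primrec tm_value :: "'a arith \<Rightarrow> ('c \<Rightarrow> 'a) \<Rightarrow> (nat \<Rightarrow> 'a) \<Rightarrow> 'c tm \<Rightarrow> 'a" where
  "tm_value M d s (Var x) = s x"
| "tm_value M d s (Cst c) = d c"
| "tm_value M d s Zero = zero_el M"
| "tm_value M d s (Succ t) = succ_op M (tm_value M d s t)"
| "tm_value M d s (Plus t u) = plus_op M (tm_value M d s t) (tm_value M d s u)"
| "tm_value M d s (Times t u) = times_op M (tm_value M d s t) (tm_value M d s u)"

primrec sat :: "'a arith \<Rightarrow> ('c \<Rightarrow> 'a) \<Rightarrow> (nat \<Rightarrow> 'a) \<Rightarrow> 'c fm \<Rightarrow> bool" where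
  "sat M d s (Eq t u) \<longleftrightarrow> tm_value M d s t = tm_value M d s u"
| "sat M d s (Neg p) \<longleftrightarrow> \<not> sat M d s p"
| "sat M d s (Conj p q) \<longleftrightarrow> sat M d s p \<and> sat M d s q"
| "sat M d s (Disj p q) \<longleftrightarrow> sat M d s p \<or> sat M d s q"
| "sat M d s (Imp p q) \<longleftrightarrow> (sat M d s p \<longrightarrow> sat M d s q)"
| "sat M d s (All x p) \<longleftrightarrow> (\<forall>a\<in>univ M. sat M d (s(x := a)) p)"
| "sat M d s (Ex x p) \<longleftrightarrow> (\<exists>a\<in>univ M. sat M d (s(x := a)) p)"

definition true_in :: "'a arith \<Rightarrow> ('c \<Rightarrow> 'a) \<Rightarrow> 'c fm \<Rightarrow> bool" where
  "true_in M d p \<longleftrightarrow> (\<forall>s. range s \<subseteq> univ M \<longrightarrow> sat M d s p)"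

section \<open>Robinson semantics\<close>

text \<open>Every element of \<open>M\<close> is named by a constant from \<open>V \<supseteq> K\<close>, \<open>d\<close> being the denotation, and \<open>v\<close>
  gives the quantifier-free sentences the value they have in \<open>M\<close>; the truth values of quantified
  sentences are constrained by the inference rules only. The function \<open>\<nu>\<close> tells which natural number
  is named by an element of \<open>K\<close>. In \<open>M\<close>, such a constant names the corresponding element
  \<open>S(\<dots>S(0))\<close> of the copy of the standard model inside \<open>M\<close>. Without this requirement,
  every countable model of Robinson arithmetic would qualify, \<open>K\<close> being mapped onto its universe.\<close>

definition valuation_on ::
    "'c set \<Rightarrow> ('c \<Rightarrow> nat) \<Rightarrow> 'a arith \<Rightarrow> 'c set \<Rightarrow> ('c \<Rightarrow> 'a) \<Rightarrow> 'c valuation \<Rightarrow> bool" where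
  "valuation_on K \<nu> M V d v \<longleftrightarrow>
    is_structure M \<and> K \<subseteq> V \<and> d ` V = univ M \<and>
    (\<forall>c\<in>K. d c = (succ_op M ^^ \<nu> c) (zero_el M)) \<and>
    (\<forall>p\<in>sentences V. quantifier_free p \<longrightarrow> v p = Some (true_in M d p))"

definition carries_admissible_valuation :: "'c set \<Rightarrow> ('c \<Rightarrow> nat) \<Rightarrow> 'a arith \<Rightarrow> bool" where
  "carries_admissible_valuation K \<nu> M \<longleftrightarrow>
    (\<exists>V d v. valuation_on K \<nu> M V d v \<and> admissible K V v)"

definition satisfies_Q_omega :: "'c set \<Rightarrow> ('c \<Rightarrow> nat) \<Rightarrow> 'a arith \<Rightarrow> bool" where
  "satisfies_Q_omega K \<nu> M \<longleftrightarrow>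
    (\<exists>V d v. valuation_on K \<nu> M V d v \<and> admissible K V v \<and> robinson_Q \<subseteq> made_true v)"

end

(* Suppose that a constant e names an element that is not a numeral. Then all the quantifier-free
   sentences Neg (c = e), with c in K, are true, so the omega rule gives (ALL x) Neg (x = e). As
   universal elimination is not restricted to K, it yields Neg (e = e). Hence every element of the
   structure is a numeral, which excludes proper extensions of the standard model, and the axioms
   of Q make the map sending n to the n-th numeral an isomorphism. *)
theory Submission
  imports Defs
begin

section \<open>Isomorphism of structures\<close>

text \<open>Serves to compare two models through the standard one: the isomorphism from it onto the
  first model has to be reversed. The inverse of \<open>f\<close> preserves the operations because
  \<open>f\<close> does and is injective on a universe closed under them.\<close>

lemma isomorphic_sym:
  assumes "isomorphic M N"
  shows "isomorphic N M"
proof -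
  obtain f where f: "embedding f M N" and surj: "f ` univ M = univ N"
    using assms unfolding isomorphic_def by blast
  have M: "is_structure M" and N: "is_structure N" and inj: "inj_on f (univ M)"
    using f unfolding embedding_def by auto
  define g where "g = inv_into (univ M) f"
  have gf: "g (f a) = a" if "a \<in> univ M" for a
    using that inj by (simp add: g_def)
  have preimage: "\<exists>a\<in>univ M. b = f a" if "b \<in> univ N" for b
    using that surj by blast
  have zero: "g (zero_el N) = zero_el M"
    using gf[of "zero_el M"] f M unfolding embedding_def is_structure_def by simp
  have succ: "g (succ_op N b) = succ_op M (g b)" if b: "b \<in> univ N" for b
  proof -
    obtain a where a: "a \<in> univ M" "b = f a" using preimage[OF b] by blast
    then have "succ_op N b = f (succ_op M a)" using f unfolding embedding_def by simp
    then show ?thesis using a M gf unfolding is_structure_def by simp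
  qed
  have ops: "g (plus_op N b b') = plus_op M (g b) (g b') \<and>
      g (times_op N b b') = times_op M (g b) (g b')"
    if bs: "b \<in> univ N" "b' \<in> univ N" for b b'
  proof -
    obtain a a' where a: "a \<in> univ M" "b = f a" "a' \<in> univ M" "b' = f a'"
      using preimage[OF bs(1)] preimage[OF bs(2)] by blast
    then have "plus_op N b b' = f (plus_op M a a')" "times_op N b b' = f (times_op M a a')"
      using f unfolding embedding_def by simp_all
    then show ?thesis using a M gf unfolding is_structure_def by simp
  qed
  have "bij_betw g (univ N) (univ M)"
    unfolding g_def using inj surj by (intro bij_betw_inv_into) (simp add: bij_betw_def)
  then have "g ` univ N = univ M" "inj_on g (univ N)"
    by (auto simp: bij_betw_def)
  then have "embedding g N M \<and> g ` univ N = univ M"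
    unfolding embedding_def using M N zero succ ops by simp
  then show ?thesis unfolding isomorphic_def by blast
qed

lemma isomorphic_trans:
  assumes "isomorphic L M" and "isomorphic M N"
  shows "isomorphic L N"
proof -
  obtain f g where f: "embedding f L M" "f ` univ L = univ M"
    and g: "embedding g M N" "g ` univ M = univ N"
    using assms unfolding isomorphic_def by blast
  have fM: "f a \<in> univ M" if "a \<in> univ L" for a
    using that f(2) by blast
  have "inj_on (g \<circ> f) (univ L)"
    using f g comp_inj_on[of f "univ L" g] unfolding embedding_def by simp
  moreover have "(g \<circ> f) ` univ L \<subseteq> univ N"
    using fM g(2) by auto
  ultimately have "embedding (g \<circ> f) L N"
    using f(1) g(1) fM unfolding embedding_def by simp
  moreover have "(g \<circ> f) ` univ L = univ N"
    using f(2) g(2) by (simp only: image_comp [symmetric])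
  ultimately show ?thesis unfolding isomorphic_def by blast
qed

section \<open>Numerals\<close>

abbreviation numeral_el :: "'a arith \<Rightarrow> nat \<Rightarrow> 'a" where
  "numeral_el M n \<equiv> (succ_op M ^^ n) (zero_el M)"

lemma numeral_el_in_univ: "is_structure M \<Longrightarrow> numeral_el M n \<in> univ M"
  by (induction n) (auto simp: is_structure_def)

text \<open>Preservation of zero and successor leaves no choice for an embedding of the standard
  model, so its image is exactly the set of numerals.\<close>

lemma embedding_standard_numeral:
  assumes "embedding f standard_model M"
  shows "f n = numeral_el M n"
proof (induction n)
  case 0
  then show ?case using assms by (simp add: embedding_def standard_model_def)
next
  case (Suc n)
  have "f (Suc n) = succ_op M (f n)"
    using assms by (simp add: embedding_def standard_model_def)
  then show ?case using Suc by simp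
qed

text \<open>The successor axioms keep distinct numerals apart, and the recursion equations determine
  sums and products of numerals by induction on the second argument. Since numerals exhaust the
  universe, nothing else remains to be matched.\<close>

lemma numeral_isomorphism:
  assumes M: "is_structure M" and univ: "univ M \<subseteq> range (numeral_el M)"
    and S_nonzero: "\<And>a. a \<in> univ M \<Longrightarrow> succ_op M a \<noteq> zero_el M"
    and S_inj: "\<And>a b. \<lbrakk>a \<in> univ M; b \<in> univ M; succ_op M a = succ_op M b\<rbrakk> \<Longrightarrow> a = b"
    and plus_0: "\<And>a. a \<in> univ M \<Longrightarrow> plus_op M a (zero_el M) = a"
    and plus_S: "\<And>a b. \<lbrakk>a \<in> univ M; b \<in> univ M\<rbrakk> \<Longrightarrow>
      plus_op M a (succ_op M b) = succ_op M (plus_op M a b)"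
    and times_0: "\<And>a. a \<in> univ M \<Longrightarrow> times_op M a (zero_el M) = zero_el M"
    and times_S: "\<And>a b. \<lbrakk>a \<in> univ M; b \<in> univ M\<rbrakk> \<Longrightarrow>
      times_op M a (succ_op M b) = plus_op M (times_op M a b) a"
  shows "isomorphic standard_model M"
proof -
  note num = numeral_el_in_univ[OF M]
  have inj: "m = n" if "numeral_el M m = numeral_el M n" for m n
    using that
  proof (induction m arbitrary: n)
    case 0
    then show ?case using S_nonzero[OF num] by (cases n) (auto dest: sym)
  next
    case (Suc m)
    show ?case
    proof (cases n)
      case 0
      then show ?thesis using Suc.prems S_nonzero[OF num] by simp
    next
      case (Suc k)
      then show ?thesis using Suc.prems Suc.IH S_inj[OF num num] by simp
    qed
  qed
  have plus: "numeral_el M (m + n) = plus_op M (numeral_el M m) (numeral_el M n)" for m n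
    by (induction n) (simp_all add: plus_0 plus_S num)
  have times: "numeral_el M (m * n) = times_op M (numeral_el M m) (numeral_el M n)" for m n
  proof (induction n)
    case 0
    then show ?case by (simp add: times_0 num)
  next
    case (Suc n)
    \<comment> \<open>The summands are exchanged among the natural numbers that index the numerals;
      commutativity of \<open>plus_op M\<close> is not assumed.\<close>
    have "numeral_el M (m * Suc n) = plus_op M (numeral_el M (m * n)) (numeral_el M m)"
      by (simp only: plus[symmetric] mult_Suc_right add.commute)
    then show ?case using Suc by (simp add: times_S num)
  qed
  have "embedding (numeral_el M) standard_model M"
    using M num plus times inj
    by (auto simp: embedding_def standard_model_def is_structure_def inj_on_def)
  moreover have "numeral_el M ` univ standard_model = univ M"
    using univ num by (auto simp: standard_model_def)
  ultimately show ?thesis unfolding isomorphic_def by blast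
qed

section \<open>Quantifier rules for admissible valuations\<close>

lemma finite_set_tm: "finite (set_tm t)"
  by (induction t) auto

lemma finite_set_fm: "finite (set_fm p)"
  by (induction p) (auto simp: finite_set_tm)

lemma made_true_sentence:
  assumes "admissible K V v" and "p \<in> made_true v"
  shows "p \<in> sentences V"
  using assms unfolding admissible_def permissible_def made_true_def by blast

lemma admissible_AllE:
  assumes K: "countable K" "K \<subseteq> V" and v: "admissible K V v"
    and all: "All x p \<in> made_true v" and e: "e \<in> V"
  shows "subst x (Cst e) p \<in> made_true v"
proof -
  have s: "All x p \<in> sentences V" using made_true_sentence[OF v all] .
  \<comment> \<open>The rule wants a countable parameter set, while \<open>V\<close> may be
    uncountable: adding to \<open>K\<close> only \<open>e\<close> and the finitely many constants of
    \<open>p\<close> suffices.\<close>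
  define C where "C = insert e (K \<union> set_fm p)"
  have "C \<in> param_sets K V"
    using K e s finite_set_fm[of p]
    by (auto simp: param_sets_def C_def sentences_def countable_finite)
  moreover have "p \<in> formulas_in x C"
    using s by (auto simp: formulas_in_def C_def sentences_def)
  moreover have "e \<in> C" by (simp add: C_def)
  moreover have "derives K V {All x p} (All x p)" using s by (simp add: Assm)
  ultimately have "derives K V {All x p} (subst x (Cst e) p)" by (rule AllE)
  then show ?thesis using v all unfolding admissible_def by blast
qed

lemma admissible_omega:
  assumes K: "countable K" "K \<subseteq> V" and v: "admissible K V v"
    and p: "p \<in> formulas_in x V"
    and inst: "\<And>c. c \<in> K \<Longrightarrow> subst x (Cst c) p \<in> made_true v"
  shows "All x p \<in> made_true v"
proof -
  have "K \<union> set_fm p \<in> param_sets K V"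
    using K p finite_set_fm[of p] by (auto simp: param_sets_def formulas_in_def countable_finite)
  moreover have "p \<in> formulas_in x (K \<union> set_fm p)"
    using p by (auto simp: formulas_in_def)
  \<comment> \<open>Taking all true sentences as assumptions lets a single sequent have the whole,
    possibly infinite, family of instances as premises.\<close>
  moreover have "\<forall>c\<in>K. derives K V (made_true v) (subst x (Cst c) p)"
    using inst made_true_sentence[OF v] by (blast intro: Assm)
  ultimately have "derives K V (made_true v) (All x p)" by (rule AllI_omega)
  then show ?thesis using v unfolding admissible_def by blast
qed

section \<open>Robinson semantics\<close>

lemma valuation_on_quantifier_free:
  assumes "valuation_on K \<nu> M V d v" and "p \<in> sentences V" and "quantifier_free p"
  shows "p \<in> made_true v \<longleftrightarrow> true_in M d p"
  using assms by (simp add: valuation_on_def made_true_def)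

text \<open>Truth quantifies over assignments into the universe; zero provides one, so truth is
  never vacuous.\<close>

lemma true_in_sat:
  assumes "is_structure M" and "true_in M d p"
  shows "sat M d (\<lambda>_. zero_el M) p"
  using assms by (auto simp: true_in_def is_structure_def)

text \<open>Serves both halves of the theorem: it makes an embedding of the standard model onto, and
  it supplies surjectivity of the numeral map in the proof of categoricity.\<close>

lemma univ_subset_numerals:
  assumes K: "countable K" and val: "valuation_on K \<nu> M V d v" and v: "admissible K V v"
  shows "univ M \<subseteq> range (numeral_el M)"
proof
  fix a assume "a \<in> univ M"
  then obtain e where e: "e \<in> V" "d e = a"
    using val unfolding valuation_on_def by (metis imageE)
  have dK: "d c = numeral_el M (\<nu> c)" if "c \<in> K" for c
    using val that unfolding valuation_on_def by auto
  have KV: "K \<subseteq> V" and M: "is_structure M"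
    using val unfolding valuation_on_def by auto
  show "a \<in> range (numeral_el M)"
  proof (rule ccontr)
    assume a: "a \<notin> range (numeral_el M)"
    \<comment> \<open>The constant \<open>e\<close> enters as a parameter, which may come from any
      countable set between \<open>K\<close> and \<open>V\<close>.\<close>
    let ?p = "Neg (Eq (Var 0) (Cst e))"
    have "subst 0 (Cst c) ?p \<in> made_true v" if c: "c \<in> K" for c
    proof -
      have "d c \<noteq> d e" using a e(2) dK[OF c] by (metis rangeI)
      moreover have "subst 0 (Cst c) ?p \<in> sentences V"
        using c KV e by (auto simp: sentences_def)
      ultimately show ?thesis
        using valuation_on_quantifier_free[OF val, of "subst 0 (Cst c) ?p"]
        by (simp add: true_in_def)
    qed
    moreover have "?p \<in> formulas_in 0 V" using e by (simp add: formulas_in_def)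
    ultimately have all: "All 0 ?p \<in> made_true v"
      by (intro admissible_omega[OF K KV v])
    have t: "subst 0 (Cst e) ?p \<in> made_true v"
      by (rule admissible_AllE[OF K KV v all e(1)])
    \<comment> \<open>A quantified sentence need not have its usual meaning in \<open>M\<close>. The
      contradiction appears only at this quantifier-free instance, whose value is that of
      \<open>M\<close>, where \<open>e\<close> equals itself.\<close>
    have "true_in M d (subst 0 (Cst e) ?p)"
      using valuation_on_quantifier_free[OF val made_true_sentence[OF v t]] t by simp
    from true_in_sat[OF M this] show False by simp
  qed
qed

text \<open>The valuation makes the axioms true, which does not say directly that \<open>M\<close>
  satisfies them. Universal elimination leads to quantifier-free instances, and on these
  \<open>v\<close> agrees with \<open>M\<close>.\<close>

lemma satisfies_Q_omega_standard:
  assumes K: "countable K" and Q: "satisfies_Q_omega K \<nu> M"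
  shows "isomorphic standard_model M"
proof -
  obtain V d v where val: "valuation_on K \<nu> M V d v" and v: "admissible K V v"
    and ax: "robinson_Q \<subseteq> made_true v"
    using Q unfolding satisfies_Q_omega_def by blast
  have M: "is_structure M" and KV: "K \<subseteq> V" and dV: "d ` V = univ M"
    using val unfolding valuation_on_def by auto
  note inst = admissible_AllE[OF K KV v]
  have sat: "sat M d (\<lambda>_. zero_el M) p" if "p \<in> made_true v" "quantifier_free p" for p
    using that valuation_on_quantifier_free[OF val made_true_sentence[OF v that(1)] that(2)]
      true_in_sat[OF M] by blast
  have sat1: "sat M d (\<lambda>_. zero_el M) (subst x (Cst e) p)"
    if "All x p \<in> robinson_Q" "quantifier_free (subst x (Cst e) p)" "e \<in> V" for x p e
    using that ax inst sat by blast
  have sat2: "sat M d (\<lambda>_. zero_el M) (subst y (Cst e') (subst x (Cst e) p))"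
    if "All x (All y p) \<in> robinson_Q" "y \<noteq> x"
      "quantifier_free (subst y (Cst e') (subst x (Cst e) p))" "e \<in> V" "e' \<in> V" for x y p e e'
  proof -
    \<comment> \<open>As \<open>y\<close> differs from \<open>x\<close>, substitution for the outer
      variable passes under the inner quantifier, and elimination can be repeated.\<close>
    have "All y (subst x (Cst e) p) \<in> made_true v"
      using that ax inst[of x "All y p" e] by auto
    then show ?thesis using inst sat that by blast
  qed
  have S_nonzero: "succ_op M (d e) \<noteq> zero_el M" if "e \<in> V" for e
    using that sat1[of 0 "Neg (Eq (Succ (Var 0)) Zero)" e] by (simp add: robinson_Q_def)
  have S_inj: "succ_op M (d e) = succ_op M (d e') \<Longrightarrow> d e = d e'" if "e \<in> V" "e' \<in> V" for e e'
    using that sat2[of 0 1 "Imp (Eq (Succ (Var 0)) (Succ (Var 1))) (Eq (Var 0) (Var 1))" e' e]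
    by (simp add: robinson_Q_def)
  have plus_0: "plus_op M (d e) (zero_el M) = d e" if "e \<in> V" for e
    using that sat1[of 0 "Eq (Plus (Var 0) Zero) (Var 0)" e] by (simp add: robinson_Q_def)
  have plus_S: "plus_op M (d e) (succ_op M (d e')) = succ_op M (plus_op M (d e) (d e'))"
    if "e \<in> V" "e' \<in> V" for e e'
    using that sat2[of 0 1 "Eq (Plus (Var 0) (Succ (Var 1))) (Succ (Plus (Var 0) (Var 1)))" e' e]
    by (simp add: robinson_Q_def)
  have times_0: "times_op M (d e) (zero_el M) = zero_el M" if "e \<in> V" for e
    using that sat1[of 0 "Eq (Times (Var 0) Zero) Zero" e] by (simp add: robinson_Q_def)
  have times_S: "times_op M (d e) (succ_op M (d e')) = plus_op M (times_op M (d e) (d e')) (d e)"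
    if "e \<in> V" "e' \<in> V" for e e'
    using that
      sat2[of 0 1 "Eq (Times (Var 0) (Succ (Var 1))) (Plus (Times (Var 0) (Var 1)) (Var 0))" e' e]
    by (simp add: robinson_Q_def)
  show ?thesis
    \<comment> \<open>Every element of \<open>M\<close> has a name in \<open>V\<close>, so laws
      proved for denotations hold throughout the universe.\<close>
    by (rule numeral_isomorphism[OF M univ_subset_numerals[OF K val v]])
      (use S_nonzero S_inj plus_0 plus_S times_0 times_S in \<open>auto simp: dV[symmetric]\<close>)
qed

text \<open>The embedding must be the numeral map, and the numerals already fill
  \<open>univ M\<close>, so it is onto.\<close>

lemma no_proper_extension:
  assumes K: "countable K" and carries: "carries_admissible_valuation K \<nu> M"
  shows "\<not> proper_extension standard_model M"
proof
  assume "proper_extension standard_model M"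
  then obtain f where f: "embedding f standard_model M" "range f \<noteq> univ M"
    unfolding proper_extension_def by (auto simp: standard_model_def)
  obtain V d v where "valuation_on K \<nu> M V d v" "admissible K V v"
    using carries unfolding carries_admissible_valuation_def by blast
  then have "univ M \<subseteq> range (numeral_el M)" by (rule univ_subset_numerals[OF K])
  moreover have "f = numeral_el M" using embedding_standard_numeral[OF f(1)] by blast
  moreover have "range f \<subseteq> univ M"
    using f(1) by (simp add: embedding_def standard_model_def)
  ultimately show False using f(2) by blast
qed

theorem theorem4p1p9:
  fixes K :: "'c set" and \<nu> :: "'c \<Rightarrow> nat"
  assumes "countable K" and "\<nu> ` K = UNIV"
  shows "(\<forall>M :: 'a arith. proper_extension standard_model M \<longrightarrow>
            \<not> satisfies_Q_omega K \<nu> M \<and> \<not> carries_admissible_valuation K \<nu> M) \<and>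
         (\<forall>(M :: 'a arith) (M' :: 'b arith).
            satisfies_Q_omega K \<nu> M \<longrightarrow> satisfies_Q_omega K \<nu> M' \<longrightarrow> isomorphic M M')"
proof (intro conjI allI impI)
  fix M :: "'a arith"
  assume "proper_extension standard_model M"
  then show carries: "\<not> carries_admissible_valuation K \<nu> M"
    using no_proper_extension[OF assms(1)] by blast
  then show "\<not> satisfies_Q_omega K \<nu> M"
    unfolding satisfies_Q_omega_def carries_admissible_valuation_def by blast
next
  fix M :: "'a arith" and M' :: "'b arith"
  assume M: "satisfies_Q_omega K \<nu> M" and M': "satisfies_Q_omega K \<nu> M'"
  note standard = satisfies_Q_omega_standard[OF assms(1)]
  show "isomorphic M M'"
    \<comment> \<open>The standard model mediates between the two universes, which may have
      different types.\<close>
    by (rule isomorphic_trans[OF isomorphic_sym[OF standard[OF M]] standard[OF M']])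
qed

end
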